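(* Let $-\infty\le a_-<0<a_+\le\infty$ and $I:=\mathbb R\cap[a_-,a_+]$. Take any function $\mathsf s\colon[0,\infty]\to[-\infty,\infty]$. Then the following two conditions are equivalent to each other: (I) there exists a function $\mathsf r\colon[-\infty,\infty]\to[-\infty,\infty]$ such that the restriction of $\mathsf r$ to $[0,\infty]$ equals $\mathsf s$ and $\mathsf r=\mathsf r_\mu$ for some non-atomic zero-mean probability measure $\mu$ on $\mathcal B(\mathbb R)$ with $\operatorname{supp}\mu=I$; (II) $\mathsf s(0)=0$; $\mathsf s$ is strictly decreasing on $[0,a_+]$; $\mathsf s$ is continuous on $[0,\infty]$; and $\mathsf s=a_-$ on $[a_+,\infty]$. Moreover, under condition (II), the function $\mathsf r$ as in (I) is unique.
   Context: $\mathcal B(\mathbb R)$ is the Borel $\sigma$-algebra; $\operatorname{supp}\mu$ is the set of all $x\in\mathbb R$ each of whose open neighborhoods has positive $\mu$-measure. A probability measure $\mu$ on $\mathcal B(\mathbb R)$ is zero-mean if $\int|x|\,\mu(dx)<\infty$ and $\int x\,\mu(dx)=0$. Continuity of $[-\infty,\infty]$-valued functions is with respect to the usual topology of the extended line. For a non-atomic zero-mean probability measure $\mu$ (extended to $[-\infty,\infty]$ by $\mu(\{\pm\infty\})=0$), define $G\colon[-\infty,\infty]\to[0,\infty)$ by $G(x)=\int_{(0,x]}z\,\mu(dz)$ for $x\in[0,\infty]$ and $G(x)=\int_{[x,0)}(-z)\,\mu(dz)$ for $x\in[-\infty,0]$; let $x_{+}(h)=\inf\{x\in[0,\infty]\colon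 G(x)\ge h\}$ and $x_{-}(h)=\sup\{x\in[-\infty,0]\colon G(x)\ge h\}$ (with $\inf\emptyset=\infty$, $\sup\emptyset=-\infty$); the reciprocating function $\mathsf r_\mu\colon[-\infty,\infty]\to[-\infty,\infty]$ of $\mu$ is $\mathsf r_\mu(x)=x_-(G(x))$ for $x\in[0,\infty]$ and $\mathsf r_\mu(x)=x_+(G(x))$ for $x\in[-\infty,0]$. *)

theory Defs
  imports "HOL-Probability.Probability"
begin

text \<open>The library locale \<^locale>\<open>real_distribution\<close> expresses that a measure is a probability
  measure on the Borel sigma-algebra of the reals; \<^typ>\<open>ereal\<close> is the extended line with its
  usual order topology.\<close>

definition nonatomic :: "'a measure \<Rightarrow> bool" where
  "nonatomic M \<longleftrightarrow>
     (\<forall>A\<in>sets M. 0 < emeasure M A \<longrightarrow>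
        (\<exists>B\<in>sets M. B \<subseteq> A \<and> 0 < emeasure M B \<and> emeasure M B < emeasure M A))"

text \<open>On the real line this is the same as all singletons being null sets, which is the form
  in which the property is mostly used.\<close>

lemma nonatomic_iff_singletons_null:
  fixes M :: "real measure"
  assumes "real_distribution M"
  shows "nonatomic M \<longleftrightarrow> (\<forall>x. measure M {x} = 0)"
proof
  interpret real_distribution M by fact
  assume na: "nonatomic M"
  show "\<forall>x. measure M {x} = 0"
  proof (rule allI, rule ccontr)
    fix x assume "measure M {x} \<noteq> 0"
    then have "0 < emeasure M {x}" by (simp add: emeasure_eq_measure zero_less_measure_iff)
    then obtain B where "B \<subseteq> {x}" "0 < emeasure M B" "emeasure M B < emeasure M {x}"
      using na unfolding nonatomic_def by (metis borel_singleton events_eq_borel sets.empty_sets)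
    then show False by (auto simp: subset_singleton_iff)
  qed
next
  interpret real_distribution M by fact
  assume null: "\<forall>x. measure M {x} = 0"
  show "nonatomic M"
    unfolding nonatomic_def
  proof (intro ballI impI)
    fix A assume A: "A \<in> sets M" and pos: "0 < emeasure M A"
    define F where "F x = measure M (A \<inter> {..x})" for x
    define N where "N = density M (indicator A)"
    have [measurable]: "A \<in> sets M" by fact
    have N: "emeasure N B = emeasure M (A \<inter> B)" if "B \<in> sets M" for B
      using that A by (simp add: N_def emeasure_density indicator_inter_arith[symmetric] Int_commute)
    have N': "measure N B = measure M (A \<inter> B)" if "B \<in> sets M" for B
      using N[OF that] by (simp add: measure_def)
    have setsN: "sets N = sets borel" by (simp add: N_def)
    interpret N: finite_borel_measure N
    proof (intro finite_borel_measure.intro finite_measureI finite_borel_measure_axioms.intro)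
      have "space N = UNIV" by (simp add: N_def)
      then show "emeasure N (space N) \<noteq> \<infinity>" using N[of UNIV] by simp
    qed (simp add: setsN)
    have cdfF: "cdf N = F" by (rule ext) (simp add: cdf_def F_def N')
    have cont: "isCont F x" for x
    proof -
      have "measure N {x} \<le> measure M {x}" by (simp add: N') (rule finite_measure_mono, auto)
      then have "measure N {x} = 0" using null measure_nonneg[of N "{x}"]
        by (metis order_antisym)
      then show ?thesis using N.isCont_cdf cdfF by simp
    qed
    have m: "measure N (space N) = measure M A" using N'[of UNIV] by (simp add: N_def)
    have mpos: "0 < measure M A" using pos by (simp add: emeasure_eq_measure)
    have "(F \<longlongrightarrow> 0) at_bot" using N.cdf_lim_at_bot cdfF by simp
    then have "eventually (\<lambda>x. F x < measure M A / 2) at_bot"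
      by (rule order_tendstoD) (use mpos in simp)
    then obtain a where a: "\<And>x. x \<le> a \<Longrightarrow> F x < measure M A / 2"
      unfolding eventually_at_bot_linorder by blast
    have "(F \<longlongrightarrow> measure M A) at_top" using N.cdf_lim_at_top cdfF m by simp
    then have "eventually (\<lambda>x. F x > measure M A / 2) at_top"
      by (rule order_tendstoD) (use mpos in simp)
    then obtain b where b: "\<And>x. x \<ge> b \<Longrightarrow> F x > measure M A / 2"
      unfolding eventually_at_top_linorder by blast
    have "\<exists>x\<ge>a. x \<le> max a b \<and> F x = measure M A / 2"
      by (rule IVT) (use a[of a] b[of "max a b"] cont in auto)
    then obtain x where "F x = measure M A / 2" by blast
    then show "\<exists>B\<in>sets M. B \<subseteq> A \<and> 0 < emeasure M B \<and> emeasure M B < emeasure M A"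
      using mpos by (intro bexI[of _ "A \<inter> {..x}"])
        (auto simp: F_def emeasure_eq_measure ennreal_less_iff)
  qed
qed

definition zero_mean :: "real measure \<Rightarrow> bool" where
  "zero_mean M \<longleftrightarrow> integrable M (\<lambda>x. x) \<and> (LINT x|M. x) = 0"

definition msupp :: "'a::topological_space measure \<Rightarrow> 'a set" where
  "msupp M = {x. \<forall>U. open U \<and> x \<in> U \<longrightarrow> 0 < emeasure M U}"

text \<open>The measure lives on \<^typ>\<open>real\<close> rather than on the extended line; since the infinite points
  carry no mass, integrating over the real points of \<open>(0,x]\<close> and \<open>[x,0)\<close> loses nothing.\<close>

definition G_fun :: "real measure \<Rightarrow> ereal \<Rightarrow> real" where
  "G_fun M x =
     (if 0 \<le> x then LINT z:{z. 0 < z \<and> ereal z \<le> x}|M. z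
      else LINT z:{z. x \<le> ereal z \<and> z < 0}|M. - z)"

text \<open>In \<^typ>\<open>ereal\<close>, the infimum of the empty set is \<open>\<infinity>\<close> and its supremum is \<open>-\<infinity>\<close>.\<close>

definition x_plus :: "real measure \<Rightarrow> real \<Rightarrow> ereal" where
  "x_plus M h = Inf {x. 0 \<le> x \<and> h \<le> G_fun M x}"

definition x_minus :: "real measure \<Rightarrow> real \<Rightarrow> ereal" where
  "x_minus M h = Sup {x. x \<le> 0 \<and> h \<le> G_fun M x}"

definition reciprocating :: "real measure \<Rightarrow> ereal \<Rightarrow> ereal" where
  "reciprocating M x = (if 0 \<le> x then x_minus M (G_fun M x) else x_plus M (G_fun M x))"

lemma G_fun_zero [simp]: "G_fun M 0 = 0"
  by (auto simp: G_fun_def set_lebesgue_integral_def indicator_def intro!: integral_eq_zero_AE)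

lemma G_fun_nonneg: "0 \<le> G_fun M x"
  unfolding G_fun_def set_lebesgue_integral_def
  by (auto intro!: Bochner_Integration.integral_nonneg simp: indicator_def  simp del: integral_minus)

text \<open>The two branches agree at \<open>0\<close>, so splitting on \<open>0 \<le> x\<close> is unambiguous.\<close>

lemma reciprocating_zero:
  "reciprocating M 0 = x_minus M (G_fun M 0)" "reciprocating M 0 = x_plus M (G_fun M 0)"
  by (auto simp: reciprocating_def x_plus_def x_minus_def G_fun_nonneg
      intro!: Sup_eqI Inf_eqI antisym Sup_least Inf_greatest Sup_upper Inf_lower)

text \<open>A function \<open>s\<close> on \<open>[0,\<infinity>]\<close> is represented by a total function on \<^typ>\<open>ereal\<close> whose values
  at negative arguments are irrelevant. A function \<open>r\<close> on \<open>[-\<infinity>,\<infinity>]\<close> is a function on all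
  of \<^typ>\<open>ereal\<close>.\<close>

definition reciprocating_extension ::
    "ereal \<Rightarrow> ereal \<Rightarrow> (ereal \<Rightarrow> ereal) \<Rightarrow> (ereal \<Rightarrow> ereal) \<Rightarrow> bool" where
  "reciprocating_extension am ap s r \<longleftrightarrow>
     (\<forall>x\<in>{0..\<infinity>}. r x = s x) \<and>
     (\<exists>M. real_distribution M \<and> nonatomic M \<and> zero_mean M \<and>
        msupp M = {x. am \<le> ereal x \<and> ereal x \<le> ap} \<and> r = reciprocating M)"

end

theory Submission
  imports Defs
begin

text \<open>On \<open>[0,a\<^sub>+]\<close> the function \<open>G\<close> is continuous and strictly increasing, on \<open>[a\<^sub>-,0]\<close> it is
  continuous and strictly decreasing, and it is constant beyond; zero mean makes the two end values
  agree. So \<open>r\<close> exchanges the two halves of the interval by matching values of \<open>G\<close>, which gives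
  (II), and its values at negative arguments are those of the inverse of \<open>s\<close>, which gives
  uniqueness. Conversely, for \<open>s\<close> as in (II), choose \<open>x > 0\<close> at random with a density that is
  positive on \<open>(0,a\<^sub>+)\<close>, and then one of the points \<open>x\<close> and \<open>s x\<close> with the odds that make the mean
  zero. This mixture of zero-mean two-point laws has reciprocating function \<open>s\<close> on \<open>[0,\<infinity>]\<close>,
  since \<open>x\<close> and \<open>s x\<close> contribute equally to \<open>G\<close>.\<close>

section \<open>Support and partial means\<close>

lemma null_compl_msupp:
  fixes M :: "'a::second_countable_topology measure"
  assumes sets: "sets M = sets borel"
  shows "- msupp M \<in> null_sets M"
proof -
  obtain B :: "'a set set" where B: "countable B" "\<And>C. C \<in> B \<Longrightarrow> open C"
      "\<And>S. open S \<Longrightarrow> \<exists>U. U \<subseteq> B \<and> S = \<Union>U"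
    by (metis univ_second_countable)
  \<comment> \<open>Every point outside the support has a null open neighbourhood and hence a null
    member of the countable base \<open>B\<close>. The complement of the support is thus a countable
    union of null sets.\<close>
  define B0 where "B0 = {C \<in> B. emeasure M C = 0}"
  have "\<exists>C\<in>B0. x \<in> C" if "x \<notin> msupp M" for x
  proof -
    have "\<not> (\<forall>U. open U \<and> x \<in> U \<longrightarrow> 0 < emeasure M U)"
      using that by (simp only: msupp_def mem_Collect_eq simp_thms)
    then obtain U where U: "open U" "x \<in> U" "\<not> 0 < emeasure M U"
      by blast
    obtain V where V: "V \<subseteq> B" "U = \<Union>V" using B(3)[OF U(1)] by blast
    then obtain C where C: "C \<in> V" "x \<in> C" using U(2) by blast
    have "emeasure M C \<le> emeasure M U"
      using C V U(1) by (intro emeasure_mono) (auto simp: sets)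
    then have "emeasure M C = 0" using U(3) by (simp add: zero_less_iff_neq_zero)
    then show ?thesis using C V by (auto simp: B0_def)
  qed
  then have "- msupp M = \<Union>B0"
    using B(2) by (fastforce simp: B0_def msupp_def)
  moreover have "\<Union>B0 \<in> null_sets M"
  proof -
    have "(\<Union>C\<in>B0. C) \<in> null_sets M"
      by (rule null_sets_UN') (auto simp: B0_def null_sets_def sets B intro: countable_subset[OF _ B(1)])
    then show ?thesis by simp
  qed
  ultimately show ?thesis by simp
qed

text \<open>Taking \<open>X\<close> to be the identity or its negative gives the two branches of
  \<open>G_fun\<close>. Continuity, strict monotonicity and eventual constancy can therefore be
  proved once for both.\<close>

definition partial_mean :: "'a measure \<Rightarrow> ('a \<Rightarrow> real) \<Rightarrow> ereal \<Rightarrow> real" where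
  "partial_mean M X x = (LINT \<omega>:{\<omega>. 0 < X \<omega> \<and> ereal (X \<omega>) \<le> x}|M. X \<omega>)"

lemma G_fun_eq_partial_mean: "0 \<le> x \<Longrightarrow> G_fun M x = partial_mean M (\<lambda>z. z) x"
  by (simp add: G_fun_def partial_mean_def)

lemma partial_mean_zero [simp]: "partial_mean M X 0 = 0"
  by (auto simp: partial_mean_def set_lebesgue_integral_def indicator_def intro!: integral_eq_zero_AE)

lemma G_fun_eq_partial_mean_uminus:
  assumes "x \<le> 0" shows "G_fun M x = partial_mean M (\<lambda>z. - z) (- x)"
\<comment> \<open>At \<open>0\<close> the definition of \<open>G_fun\<close> takes its positive
  branch, so this point is separated; both sides vanish there.\<close>
proof (cases "x = 0")
  case False
  then have "\<not> 0 \<le> x" using assms by auto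
  moreover have "{z. x \<le> ereal z \<and> z < 0} = {\<omega>. 0 < - \<omega> \<and> ereal (- \<omega>) \<le> - x}"
    by (auto simp: ereal_uminus_le_reorder simp flip: uminus_ereal.simps)
  ultimately show ?thesis by (simp add: G_fun_def partial_mean_def)
qed simp

context real_distribution
begin

context
  fixes X :: "real \<Rightarrow> real"
  assumes X: "integrable M X"
begin

lemma measurable_X [measurable]: "X \<in> borel_measurable borel"
  using borel_measurable_integrable[OF X] by (simp add: measurable_def)

lemma integrable_partial_mean:
  "integrable M (\<lambda>\<omega>. indicator {\<omega>. 0 < X \<omega> \<and> ereal (X \<omega>) \<le> x} \<omega> *\<^sub>R X \<omega>)"
  by (rule integrable_mult_indicator) (auto simp: X)

text \<open>Dominated convergence with bound \<open>\<bar>X \<omega>\<bar>\<close>: wherever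
  \<open>X \<omega>\<close> differs from the limit level, the truncating indicator is eventually
  constant. The remaining event is null by \<open>null\<close> at a finite level and empty at an
  infinite one.\<close>

lemma continuous_partial_mean:
  assumes null: "\<And>c. measure M {\<omega>. X \<omega> = c} = 0"
  shows "continuous_on UNIV (partial_mean M X)"
proof (rule continuous_on_sequentiallyI)
  fix u :: "nat \<Rightarrow> ereal" and a assume u: "u \<longlonglongrightarrow> a"
  have "{\<omega>. ereal (X \<omega>) = a} \<in> null_sets M"
  proof (cases a)
    case (real c)
    then show ?thesis using null[of c] by (simp add: null_sets_def emeasure_eq_measure)
  qed auto
  then have AE: "AE \<omega> in M. ereal (X \<omega>) \<noteq> a"
    by (rule AE_I') simp
  let ?f = "\<lambda>x \<omega>. indicator {\<omega>. 0 < X \<omega> \<and> ereal (X \<omega>) \<le> x} \<omega> *\<^sub>R X \<omega>"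
  have "(\<lambda>n. integral\<^sup>L M (?f (u n))) \<longlonglongrightarrow> integral\<^sup>L M (?f a)"
  proof (rule integral_dominated_convergence[where w="\<lambda>\<omega>. \<bar>X \<omega>\<bar>"])
    show "AE \<omega> in M. (\<lambda>n. ?f (u n) \<omega>) \<longlonglongrightarrow> ?f a \<omega>"
      using AE
    proof eventually_elim
      case (elim \<omega>)
      have "eventually (\<lambda>n. ?f (u n) \<omega> = ?f a \<omega>) sequentially"
      proof (cases "ereal (X \<omega>) < a")
        case True
        from order_tendstoD(1)[OF u this] show ?thesis
          by eventually_elim (use True in \<open>auto simp: indicator_def\<close>)
      next
        case False
        then have *: "a < ereal (X \<omega>)" using elim by auto
        from order_tendstoD(2)[OF u this] show ?thesis
          by eventually_elim (use * in \<open>auto simp: indicator_def\<close>)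
      qed
      then show ?case by (rule tendsto_eventually)
    qed
  qed (use X integrable_partial_mean in \<open>auto simp: indicator_def\<close>)
  then show "(\<lambda>n. partial_mean M X (u n)) \<longlonglongrightarrow> partial_mean M X a"
    by (simp add: partial_mean_def set_lebesgue_integral_def)
qed

text \<open>Between two levels fit reals \<open>p < q\<close>. The event
  \<open>p < X \<omega> \<and> X \<omega> < q\<close> counts only at the higher level, where it adds
  at least \<open>p\<close> times its positive probability.\<close>

lemma partial_mean_strict_mono:
  assumes pos: "\<And>p q. \<lbrakk>0 < p; p < q; ereal q < b\<rbrakk> \<Longrightarrow> 0 < measure M {\<omega>. p < X \<omega> \<and> X \<omega> < q}"
  shows "strict_mono_on {0..b} (partial_mean M X)"
proof (rule strict_mono_onI)
  fix x y assume xy: "x \<in> {0..b}" "y \<in> {0..b}" "x < y"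
  obtain p where p: "x < ereal p" "ereal p < y" using ereal_dense2[OF xy(3)] by blast
  obtain q where q: "ereal p < ereal q" "ereal q < y" using ereal_dense2[OF p(2)] by blast
  have "0 < ereal p" by (rule le_less_trans[OF _ p(1)]) (use xy in auto)
  then have p0: "0 < p" by simp
  have "0 < measure M {\<omega>. p < X \<omega> \<and> X \<omega> < q}"
    using q xy p0 by (intro pos) (auto intro: less_le_trans)
  define A where "A = {\<omega>. p < X \<omega> \<and> X \<omega> < q}"
  have A [measurable]: "A \<in> sets borel" unfolding A_def by measurable
  let ?f = "\<lambda>x \<omega>. indicator {\<omega>. 0 < X \<omega> \<and> ereal (X \<omega>) \<le> x} \<omega> *\<^sub>R X \<omega>"
  have iA: "integrable M (\<lambda>\<omega>. p * indicator A \<omega>)"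
    by (intro integrable_mult_right integrable_real_indicator) (auto simp: emeasure_eq_measure)
  have "partial_mean M X x + p * measure M A = integral\<^sup>L M (\<lambda>\<omega>. ?f x \<omega> + p * indicator A \<omega>)"
    unfolding partial_mean_def set_lebesgue_integral_def
    by (subst Bochner_Integration.integral_add[OF integrable_partial_mean iA]) simp
  also have "\<dots> \<le> integral\<^sup>L M (?f y)"
  proof (rule integral_mono[OF Bochner_Integration.integrable_add[OF integrable_partial_mean iA] integrable_partial_mean])
    fix \<omega>
    have "\<omega> \<in> A \<Longrightarrow> x < ereal (X \<omega>) \<and> ereal (X \<omega>) \<le> y"
      using p q less_trans[of x "ereal p" "ereal (X \<omega>)"] less_trans[of "ereal (X \<omega>)" "ereal q" y]
      by (auto simp: A_def)
    moreover have "ereal (X \<omega>) \<le> x \<Longrightarrow> ereal (X \<omega>) \<le> y" using xy(3) by auto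
    ultimately show "?f x \<omega> + p * indicator A \<omega> \<le> ?f y \<omega>"
      using p0 by (auto simp: indicator_def A_def)
  qed
  also have "\<dots> = partial_mean M X y" by (simp add: partial_mean_def set_lebesgue_integral_def)
  finally show "partial_mean M X x < partial_mean M X y"
    using mult_pos_pos[OF p0 \<open>0 < measure M _\<close>] by (simp add: A_def)
qed

lemma partial_mean_eq_beyond:
  assumes "AE \<omega> in M. ereal (X \<omega>) \<le> b" "b \<le> x"
  shows "partial_mean M X x = partial_mean M X b"
  unfolding partial_mean_def set_lebesgue_integral_def
  by (rule integral_cong_AE) (use assms in \<open>auto elim!: eventually_mono simp: indicator_def\<close>)

end

text \<open>At level infinity these are the integrals of the negative and the positive part of
  \<open>X\<close>, whose difference is the mean.\<close>

lemma partial_mean_uminus_infinity: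
  assumes "integrable M X" "integral\<^sup>L M X = 0"
  shows "partial_mean M (\<lambda>\<omega>. - X \<omega>) \<infinity> = partial_mean M X \<infinity>"
proof -
  let ?f = "\<lambda>X \<omega>. indicator {\<omega>. 0 < X \<omega> \<and> ereal (X \<omega>) \<le> \<infinity>} \<omega> *\<^sub>R (X \<omega> :: real)"
  have "partial_mean M X \<infinity> - partial_mean M (\<lambda>\<omega>. - X \<omega>) \<infinity>
      = integral\<^sup>L M (\<lambda>\<omega>. ?f X \<omega> - ?f (\<lambda>\<omega>. - X \<omega>) \<omega>)"
    unfolding partial_mean_def set_lebesgue_integral_def
    by (rule Bochner_Integration.integral_diff[symmetric];
        rule integrable_partial_mean) (use assms in auto)
  also have "\<dots> = integral\<^sup>L M X"
    by (rule Bochner_Integration.integral_cong) (auto simp: indicator_def)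
  finally show ?thesis using assms by simp
qed

end

section \<open>The function G for measures as in (I)\<close>

locale centered_interval_distribution = real_distribution +
  fixes a_minus a_plus :: ereal
  assumes nonatomic: "nonatomic M" and zero_mean: "zero_mean M"
    and msupp: "msupp M = {x. a_minus \<le> ereal x \<and> ereal x \<le> a_plus}"
    and neg: "a_minus < 0" and pos: "0 < a_plus"
begin

lemma integrable_id: "integrable M (\<lambda>x. x)" and mean_zero: "(LINT x|M. x) = 0"
  using zero_mean by (auto simp: zero_mean_def)

lemma singleton_null: "measure M {x} = 0"
  using nonatomic nonatomic_iff_singletons_null[OF real_distribution_axioms] by simp

lemma AE_in_interval: "AE x in M. a_minus \<le> ereal x \<and> ereal x \<le> a_plus"
  by (rule AE_I'[OF null_compl_msupp]) (auto simp: msupp)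

lemma measure_greaterThanLessThan_pos:
  assumes "p < q" "a_minus \<le> ereal p" "ereal q \<le> a_plus"
  shows "0 < measure M {p<..<q}"
proof -
  \<comment> \<open>An inner point lies in the support and has the whole open interval as a
    neighbourhood, even if \<open>p\<close> or \<open>q\<close> is an endpoint of the
    support.\<close>
  obtain m where m: "p < m" "m < q" using dense[OF assms(1)] by blast
  have "a_minus \<le> ereal m" "ereal m \<le> a_plus"
    using assms m by (auto intro: order_trans[OF assms(2)] order_trans[OF _ assms(3)])
  then have "m \<in> msupp M" by (simp add: msupp)
  then have "0 < emeasure M {p<..<q}" using m by (auto simp: msupp_def)
  then show ?thesis by (simp add: emeasure_eq_measure)
qed

lemma G_fun_strict_mono: "strict_mono_on {0..a_plus} (G_fun M)"
proof -
  have "strict_mono_on {0..a_plus} (partial_mean M (\<lambda>z. z))"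
  proof (rule partial_mean_strict_mono[OF integrable_id])
    fix p q :: real assume "0 < p" "p < q" "ereal q < a_plus"
    moreover have "a_minus \<le> ereal p" using neg \<open>0 < p\<close> by (metis ereal_less(2) less_imp_le less_trans)
    ultimately show "0 < measure M {\<omega>. p < \<omega> \<and> \<omega> < q}"
      using measure_greaterThanLessThan_pos[of p q] by (simp add: greaterThanLessThan_eq greaterThan_def lessThan_def Collect_conj_eq)
  qed
  then show ?thesis by (auto simp: monotone_on_def G_fun_eq_partial_mean)
qed

lemma G_fun_strict_antimono: "strict_antimono_on {a_minus..0} (G_fun M)"
proof -
  have *: "strict_mono_on {0..- a_minus} (partial_mean M (\<lambda>z. - z))"
  proof (rule partial_mean_strict_mono)
    fix p q :: real assume *: "0 < p" "p < q" "ereal q < - a_minus"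
    have "a_minus \<le> ereal (- q)" using * ereal_less_uminus_reorder[of "ereal q" a_minus] by auto
    moreover have "ereal (- p) \<le> a_plus"
      using \<open>0 < p\<close> by (intro order_trans[OF _ less_imp_le[OF pos]]) simp
    moreover have "{\<omega>. p < - \<omega> \<and> - \<omega> < q} = {-q<..<-p}" by auto
    ultimately show "0 < measure M {\<omega>. p < - \<omega> \<and> - \<omega> < q}"
      using measure_greaterThanLessThan_pos[of "-q" "-p"] * by simp
  qed (use integrable_id in simp)
  show ?thesis
  proof (rule monotone_onI)
    fix x y assume "x \<in> {a_minus..0}" "y \<in> {a_minus..0}" "x < y"
    then show "G_fun M y < G_fun M x"
      using strict_mono_onD[OF *, of "-y" "-x"] by (auto simp: G_fun_eq_partial_mean_uminus)
  qed
qed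

lemma continuous_G_fun_nonneg: "continuous_on {0..} (G_fun M)"
proof -
  have "continuous_on UNIV (partial_mean M (\<lambda>z. z))"
    by (rule continuous_partial_mean[OF integrable_id]) (use singleton_null in simp)
  then have "continuous_on {0..} (partial_mean M (\<lambda>z. z))"
    by (rule continuous_on_subset) simp
  then show ?thesis by (rule continuous_on_cong[THEN iffD1, rotated -1]) (auto simp: G_fun_eq_partial_mean)
qed

lemma continuous_G_fun_nonpos: "continuous_on {..0} (G_fun M)"
proof -
  have "{\<omega>. - \<omega> = c} = {- c}" for c :: real by auto
  then have "continuous_on UNIV (partial_mean M (\<lambda>z. - z))"
    by (intro continuous_partial_mean) (use singleton_null integrable_id in auto)
  then have "continuous_on {..0} (\<lambda>x. partial_mean M (\<lambda>z. - z) (- x))"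
    by (rule continuous_on_compose2) (auto simp: continuous_on_def)
  then show ?thesis
    by (rule continuous_on_cong[THEN iffD1, rotated -1]) (auto simp: G_fun_eq_partial_mean_uminus)
qed

lemma G_fun_above: "a_plus \<le> x \<Longrightarrow> G_fun M x = G_fun M a_plus"
  using AE_in_interval pos partial_mean_eq_beyond[OF integrable_id, of a_plus x]
  by (auto simp: G_fun_eq_partial_mean elim!: eventually_mono)

lemma G_fun_below: "x \<le> a_minus \<Longrightarrow> G_fun M x = G_fun M a_minus"
proof -
  assume x: "x \<le> a_minus"
  have "partial_mean M (\<lambda>z. - z) (- x) = partial_mean M (\<lambda>z. - z) (- a_minus)"
  proof (rule partial_mean_eq_beyond)
    show "AE \<omega> in M. ereal (- \<omega>) \<le> - a_minus"
      using AE_in_interval by eventually_elim (simp flip: uminus_ereal.simps)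
  qed (use x integrable_id in auto)
  then show ?thesis using x neg by (auto simp: G_fun_eq_partial_mean_uminus)
qed

text \<open>This is where the zero mean enters: it equates the values of G at the two infinite
  points, and G is constant from each endpoint outwards.\<close>

lemma G_fun_endpoints: "G_fun M a_minus = G_fun M a_plus"
proof -
  have "G_fun M (-\<infinity>) = G_fun M \<infinity>"
    using partial_mean_uminus_infinity[OF integrable_id mean_zero]
    by (simp add: G_fun_eq_partial_mean G_fun_eq_partial_mean_uminus)
  then show ?thesis using G_fun_above[of \<infinity>] G_fun_below[of "-\<infinity>"] by simp
qed

section \<open>The reciprocating function and condition (II)\<close>

lemma x_minus_G_fun: "y \<in> {a_minus..0} \<Longrightarrow> x_minus M (G_fun M y) = y"
  unfolding x_minus_def
proof (rule Sup_eqI)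
  fix x assume y: "y \<in> {a_minus..0}" and "x \<in> {x. x \<le> 0 \<and> G_fun M y \<le> G_fun M x}"
  \<comment> \<open>If \<open>y < x\<close>, then \<open>x\<close> also lies in
    \<open>{a_minus..0}\<close>, and the strict decrease of G there contradicts
    \<open>G_fun M y \<le> G_fun M x\<close>.\<close>
  then show "x \<le> y"
    using monotone_onD[OF G_fun_strict_antimono, of y x] by force
qed auto

lemma x_plus_G_fun: "x \<in> {0..a_plus} \<Longrightarrow> x_plus M (G_fun M x) = x"
  unfolding x_plus_def
proof (rule Inf_eqI)
  fix y assume x: "x \<in> {0..a_plus}" and "y \<in> {y. 0 \<le> y \<and> G_fun M x \<le> G_fun M y}"
  then show "x \<le> y"
    using monotone_onD[OF G_fun_strict_mono, of y x] by force
qed auto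

text \<open>On the nonnegative side G does not exceed its value at \<open>a_plus\<close>, which is
  also its value at \<open>a_minus\<close>. On \<open>{a_minus..0}\<close> every level from
  \<open>0\<close> up to that value is attained by the intermediate value theorem.\<close>

lemma ex_nonpos_same_G_fun:
  assumes "0 \<le> x" shows "\<exists>y\<in>{a_minus..0}. G_fun M y = G_fun M x"
proof -
  have "G_fun M x \<le> G_fun M a_minus"
  proof (cases "x < a_plus")
    case True
    then show ?thesis
      using monotone_onD[OF G_fun_strict_mono, of x a_plus] assms pos by (auto simp: G_fun_endpoints less_imp_le)
  next
    case False
    then show ?thesis using G_fun_above[of x] by (auto simp: G_fun_endpoints)
  qed
  moreover have "continuous_on {a_minus..0} (G_fun M)"
    by (rule continuous_on_subset[OF continuous_G_fun_nonpos]) auto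
  ultimately show ?thesis
    using IVT2'[of "G_fun M" 0 "G_fun M x" a_minus] less_imp_le[OF neg] by (auto simp: G_fun_nonneg)
qed

lemma ex_nonneg_same_G_fun:
  assumes "x \<le> 0" shows "\<exists>y\<in>{0..a_plus}. G_fun M y = G_fun M x"
proof -
  have "G_fun M x \<le> G_fun M a_plus"
  proof (cases "a_minus < x")
    case True
    then show ?thesis
      using monotone_onD[OF G_fun_strict_antimono, of a_minus x] assms neg
      by (auto simp: less_imp_le simp flip: G_fun_endpoints)
  next
    case False
    then show ?thesis using G_fun_below[of x] by (auto simp: G_fun_endpoints)
  qed
  moreover have "continuous_on {0..a_plus} (G_fun M)"
    by (rule continuous_on_subset[OF continuous_G_fun_nonneg]) auto
  ultimately show ?thesis
    using IVT'[of "G_fun M" 0 "G_fun M x" a_plus] less_imp_le[OF pos] by (auto simp: G_fun_nonneg)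
qed

text \<open>This replaces the supremum in the definition by matching values of G; the values at
  nonnegative arguments are computed through it below.\<close>

lemma reciprocating_eqI:
  assumes "0 \<le> x" "y \<in> {a_minus..0}" "G_fun M y = G_fun M x"
  shows "reciprocating M x = y"
  using x_minus_G_fun[OF assms(2)] assms by (simp add: reciprocating_def)

lemma reciprocating_nonneg:
  assumes "0 \<le> x"
  shows "reciprocating M x \<in> {a_minus..0}" "G_fun M (reciprocating M x) = G_fun M x"
  using ex_nonpos_same_G_fun[OF assms] reciprocating_eqI[OF assms] by auto

text \<open>The truncation at \<open>a_minus\<close> appears because G is constant below that point.
  The outer application has a nonnegative argument, so it is a value of \<open>s\<close>; this is
  how \<open>s\<close> determines the values at negative arguments.\<close>

lemma reciprocating_nonpos:
  assumes "x < 0"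
  shows "reciprocating M x \<in> {0..a_plus}" "reciprocating M (reciprocating M x) = max x a_minus"
proof -
  obtain y where y: "y \<in> {0..a_plus}" "G_fun M y = G_fun M x"
    using ex_nonneg_same_G_fun assms by (metis less_imp_le)
  have r: "reciprocating M x = y"
    using x_plus_G_fun[OF y(1)] y assms by (auto simp: reciprocating_def)
  show "reciprocating M x \<in> {0..a_plus}" using r y by simp
  have "G_fun M (max x a_minus) = G_fun M x"
    using G_fun_below[of x] by (simp add: max_def)
  then show "reciprocating M (reciprocating M x) = max x a_minus"
    unfolding r using y assms neg by (intro reciprocating_eqI) (auto simp: max_def)
qed

lemma reciprocating_strict_antimono: "strict_antimono_on {0..a_plus} (reciprocating M)"
proof (rule monotone_onI)
  fix x y assume xy: "x \<in> {0..a_plus}" "y \<in> {0..a_plus}" "x < y"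
  let ?r = "reciprocating M"
  have "G_fun M (?r x) < G_fun M (?r y)"
    using monotone_onD[OF G_fun_strict_mono xy] xy reciprocating_nonneg(2) by simp
  moreover have "G_fun M (?r y) < G_fun M (?r x)" if "?r x < ?r y"
    using monotone_onD[OF G_fun_strict_antimono _ _ that] xy reciprocating_nonneg(1) by simp
  ultimately show "?r y < ?r x" by (metis less_irrefl less_trans linorder_neqE)
qed

text \<open>The interval \<open>{a_minus..0}\<close> is compact in the extended line, so the
  continuous injection G has a continuous inverse on its image, namely \<open>x_minus M\<close>. The
  reciprocating function is the composition of this inverse with G.\<close>

lemma continuous_reciprocating: "continuous_on {0..} (reciprocating M)"
proof -
  have "continuous_on (G_fun M ` {a_minus..0}) (x_minus M)"
    by (rule continuous_on_inv[OF continuous_on_subset[OF continuous_G_fun_nonpos]])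
      (auto simp: x_minus_G_fun compact_eq_closed)
  moreover have "G_fun M ` {0..} \<subseteq> G_fun M ` {a_minus..0}"
    by (rule image_subsetI) (metis atLeast_iff ex_nonpos_same_G_fun image_eqI)
  ultimately have "continuous_on {0..} (\<lambda>x. x_minus M (G_fun M x))"
    by (rule continuous_on_compose2[OF _ continuous_G_fun_nonneg])
  then show ?thesis
    by (rule continuous_on_cong[THEN iffD1, rotated -1]) (auto simp: reciprocating_def)
qed

lemma reciprocating_above: "a_plus \<le> x \<Longrightarrow> reciprocating M x = a_minus"
  using pos neg G_fun_above[of x] G_fun_endpoints by (intro reciprocating_eqI) auto

lemma reciprocating_0: "reciprocating M 0 = 0"
  using neg by (intro reciprocating_eqI) auto

end

section \<open>Encoding the pairs of atoms for a function s as in (II)\<close>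

lemma open_not_null_lborel:
  fixes S :: "'a::euclidean_space set"
  assumes "open S" "S \<noteq> {}" shows "S \<notin> null_sets lborel"
  using open_not_negligible[OF assms] by (auto simp: negligible_iff_null_sets null_sets_completionI)

locale decreasing_extension =
  fixes a_minus a_plus :: ereal and s :: "ereal \<Rightarrow> ereal"
  assumes neg: "a_minus < 0" and pos: "0 < a_plus" and s_0: "s 0 = 0"
    and strict_antimono: "strict_antimono_on {0..a_plus} s"
    and continuous: "continuous_on {0..} s"
    and s_above: "a_plus \<le> x \<Longrightarrow> s x = a_minus"
begin

text \<open>The two atoms of the law attached to \<open>x > 0\<close> are encoded as \<open>mirror x = x\<close> and
  \<open>mirror (- x) = s x\<close>, so that the mixture is the image under \<open>mirror\<close> of a measure with a density
  on the line, and swapping the atoms is the reflection \<open>u \<mapsto> - u\<close>.\<close>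

definition mirror :: "real \<Rightarrow> real" where
  "mirror u = (if 0 < u then u else real_of_ereal (s (ereal \<bar>u\<bar>)))"

text \<open>The strict bound by \<open>a_plus\<close> and the exclusion of \<open>0\<close> keep
  both atoms finite, nonzero and strictly inside the interval.\<close>

definition base :: "real set" where
  "base = {u. u \<noteq> 0 \<and> ereal \<bar>u\<bar> < a_plus}"

lemma s_between: "\<lbrakk>0 < x; x < a_plus\<rbrakk> \<Longrightarrow> a_minus < s x \<and> s x < 0"
  using monotone_onD[OF strict_antimono, of 0 x] monotone_onD[OF strict_antimono, of x a_plus]
    pos s_0 s_above by (auto simp: less_imp_le)

text \<open>By \<open>s_between\<close> the value of \<open>s\<close> is finite, so
  \<open>real_of_ereal\<close> loses nothing.\<close>

lemma mirror_neg: "\<lbrakk>u \<in> base; u < 0\<rbrakk> \<Longrightarrow> ereal (mirror u) = s (ereal \<bar>u\<bar>)"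
  using s_between[of "ereal \<bar>u\<bar>"] unfolding mirror_def base_def
  by (cases "s (ereal \<bar>u\<bar>)") auto

lemma mirror_in_interval:
  assumes "u \<in> base"
  shows "a_minus < ereal (mirror u)" "ereal (mirror u) < a_plus" "0 < mirror u \<longleftrightarrow> 0 < u" "mirror u < 0 \<longleftrightarrow> u < 0"
proof -
  have "a_minus < ereal (mirror u) \<and> ereal (mirror u) < a_plus \<and> (0 < mirror u \<longleftrightarrow> 0 < u) \<and> (mirror u < 0 \<longleftrightarrow> u < 0)"
  proof (cases "0 < u")
    case True
    then have "a_minus < ereal u" using neg by (metis ereal_less(2) less_trans)
    then show ?thesis using True assms by (auto simp: mirror_def base_def)
  next
    case False
    then have u: "u < 0" using assms by (auto simp: base_def)
    have "a_minus < ereal (mirror u) \<and> ereal (mirror u) < 0"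
      using s_between[of "ereal \<bar>u\<bar>"] u assms by (auto simp: mirror_neg base_def)
    moreover from this have "ereal (mirror u) < a_plus" using pos by (metis less_trans)
    ultimately show ?thesis using u by auto
  qed
  then show "a_minus < ereal (mirror u)" "ereal (mirror u) < a_plus"
    "0 < mirror u \<longleftrightarrow> 0 < u" "mirror u < 0 \<longleftrightarrow> u < 0" by auto
qed

lemma uminus_base [simp]: "- u \<in> base \<longleftrightarrow> u \<in> base"
  by (simp add: base_def)

lemma open_base: "open base"
proof -
  have "base = - {0} \<inter> (\<lambda>u. ereal \<bar>u\<bar>) -` {..<a_plus}" by (auto simp: base_def)
  moreover have "open ((\<lambda>u::real. ereal \<bar>u\<bar>) -` {..<a_plus})"
    by (intro open_vimage continuous_intros)
  ultimately show ?thesis by auto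
qed

lemma base_not_empty: "base \<noteq> {}"
proof -
  obtain u where "0 < ereal u" "ereal u < a_plus" using ereal_dense2[OF pos] by blast
  then have "u \<in> base" by (auto simp: base_def)
  then show ?thesis by blast
qed

lemma continuous_s_abs: "continuous_on A (\<lambda>u::real. s (ereal \<bar>u\<bar>))"
  by (rule continuous_on_compose2[OF continuous]) (auto intro!: continuous_intros)

lemma measurable_mirror [measurable]: "mirror \<in> borel_measurable borel"
proof -
  have [measurable]: "(\<lambda>u::real. s (ereal \<bar>u\<bar>)) \<in> borel_measurable borel"
    by (rule borel_measurable_continuous_onI[OF continuous_s_abs])
  show ?thesis unfolding mirror_def[abs_def] by measurable
qed

text \<open>On the positive half \<open>mirror\<close> is the identity; on the negative half
  continuity is inherited from \<open>s\<close> through the extended line. Both halves are open, so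
  the pieces glue.\<close>

lemma continuous_mirror: "continuous_on base mirror"
proof -
  have "continuous_on (base \<inter> {0<..}) mirror"
    by (rule continuous_on_eq[OF continuous_on_id]) (auto simp: mirror_def)
  moreover have "continuous_on (base \<inter> {..<0}) mirror"
    by (rule continuous_on_iff_ereal[THEN iffD2, rotated, OF continuous_on_eq[OF continuous_s_abs]])
      (auto simp: mirror_neg open_base)
  ultimately have "continuous_on (base \<inter> {0<..} \<union> base \<inter> {..<0}) mirror"
    by (intro continuous_on_open_Un open_Int open_base) auto
  moreover have "base \<inter> {0<..} \<union> base \<inter> {..<0} = base" by (auto simp: base_def)
  ultimately show ?thesis by simp
qed

lemma inj_on_mirror: "inj_on mirror base"
proof (rule inj_onI)
  fix u v assume uv: "u \<in> base" "v \<in> base" "mirror u = mirror v"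
  then have sgn: "0 < u \<longleftrightarrow> 0 < v" "u < 0 \<longleftrightarrow> v < 0"
    using mirror_in_interval[of u] mirror_in_interval[of v] by auto
  show "u = v"
  proof (cases "0 < u")
    case True
    then show ?thesis using uv sgn by (simp add: mirror_def)
  next
    case False
    then have n: "u < 0" "v < 0" using uv(1) sgn by (auto simp: base_def)
    then have "s (ereal \<bar>u\<bar>) = s (ereal \<bar>v\<bar>)" using uv mirror_neg by metis
    then have "\<bar>u\<bar> = \<bar>v\<bar>"
      using monotone_onD[OF strict_antimono, of "ereal \<bar>u\<bar>" "ereal \<bar>v\<bar>"]
        monotone_onD[OF strict_antimono, of "ereal \<bar>v\<bar>" "ereal \<bar>u\<bar>"] uv
      by (cases "\<bar>u\<bar>" "\<bar>v\<bar>" rule: linorder_cases) (auto simp: base_def less_imp_le)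
    then show ?thesis using n by simp
  qed
qed

lemma mirror_surj:
  assumes "a_minus < ereal y" "ereal y < a_plus" "y \<noteq> 0"
  shows "\<exists>u\<in>base. mirror u = y"
proof (cases "0 < y")
  case True
  then show ?thesis using assms by (intro bexI[of _ y]) (auto simp: mirror_def base_def)
next
  case False
  then have y: "y < 0" using assms by simp
  have "continuous_on {0..a_plus} s" by (rule continuous_on_subset[OF continuous]) auto
  then obtain x where x: "0 \<le> x" "x \<le> a_plus" "s x = ereal y"
    using IVT2'[of s a_plus "ereal y" 0] assms y pos s_0 s_above[of a_plus] by (auto simp: less_imp_le)
  \<comment> \<open>The endpoint values \<open>0\<close> and \<open>a_minus\<close> of
    \<open>s\<close> differ from \<open>y\<close>. Excluding \<open>a_plus\<close> also makes
    \<open>x\<close> finite when \<open>a_plus\<close> is infinite.\<close>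
  have "x \<noteq> 0" "x \<noteq> a_plus" using x y assms s_0 s_above[of a_plus] by auto
  then have "0 < x" "x < a_plus" using x by auto
  then obtain u where u: "x = ereal u" by (cases x) auto
  have "- u \<in> base" using \<open>0 < x\<close> \<open>x < a_plus\<close> u by (auto simp: base_def)
  moreover have "mirror (- u) = y" using mirror_neg[of "-u"] u x \<open>0 < x\<close> calculation by auto
  ultimately show ?thesis by blast
qed

text \<open>The quotient is the probability of the atom \<open>mirror u\<close> in the zero-mean law
  on \<open>mirror u\<close> and \<open>mirror (- u)\<close>. The normal density is even, so both
  atoms share this factor; it is positive and has a finite first absolute moment.\<close>

definition weight :: "real \<Rightarrow> real" where
  "weight u = indicator base u * std_normal_density u *
     (\<bar>mirror (- u)\<bar> / (\<bar>mirror u\<bar> + \<bar>mirror (- u)\<bar>))"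

lemma measurable_weight [measurable]: "weight \<in> borel_measurable borel"
proof -
  have [measurable]: "base \<in> sets borel" using open_base by simp
  show ?thesis unfolding weight_def[abs_def] by measurable
qed

lemma std_normal_density_uminus: "std_normal_density (- u) = std_normal_density u"
  by (simp add: std_normal_density_def)

lemma weight_nonneg: "0 \<le> weight u"
  by (simp add: weight_def)

lemma weight_pos_iff: "0 < weight u \<longleftrightarrow> u \<in> base"
proof
  assume u: "u \<in> base"
  then have "mirror (- u) \<noteq> 0" using mirror_in_interval[of "-u"] by (auto simp: base_def)
  then show "0 < weight u"
    using u by (auto simp: weight_def normal_density_pos intro!: mult_pos_pos divide_pos_pos)
qed (cases "u \<in> base"; simp add: weight_def)

lemma weight_le: "weight u \<le> std_normal_density u"
proof -
  have "\<bar>mirror (- u)\<bar> / (\<bar>mirror u\<bar> + \<bar>mirror (- u)\<bar>) \<le> 1"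
    unfolding divide_le_eq_1 by arith
  then show ?thesis
    using mult_left_le[OF _ normal_density_nonneg] by (cases "u \<in> base") (simp_all add: weight_def del: times_divide_eq_right)
qed

lemma integrable_weight: "integrable lborel weight"
  by (rule Bochner_Integration.integrable_bound[OF integrable_normal_density[of 1 0]])
    (auto simp: weight_nonneg weight_le)

text \<open>The two atoms have opposite signs and each is weighted by the size of the other. This
  pointwise balance gives integrability, zero mean and the matching values of G.\<close>

lemma weight_odd: "mirror (- u) * weight (- u) = - (mirror u * weight u)"
proof (cases "u \<in> base")
  case True
  then have "mirror (- u) * \<bar>mirror u\<bar> = - (mirror u * \<bar>mirror (- u)\<bar>)"
    using mirror_in_interval(3,4)[of u] mirror_in_interval(3,4)[of "-u"]
    by (cases "0 < u") (auto simp: base_def abs_if)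
  then show ?thesis
    using True unfolding weight_def std_normal_density_uminus
    by (simp add: add.commute divide_simps mult.left_commute)
qed (simp add: weight_def)

text \<open>For negative \<open>u\<close> the value \<open>mirror u\<close> has no direct bound, but
  \<open>weight_odd\<close> transfers the estimate from \<open>- u\<close>, where
  \<open>mirror\<close> is the identity and the normal first moment dominates.\<close>

lemma integrable_mirror_weight: "integrable lborel (\<lambda>u. mirror u * weight u)"
proof (rule Bochner_Integration.integrable_bound)
  show "integrable lborel (\<lambda>u. std_normal_density u * \<bar>u\<bar> ^ 1)"
    by (rule integrable_std_normal_moment_abs)
  have *: "\<bar>mirror u * weight u\<bar> \<le> std_normal_density u * \<bar>u\<bar>" if "0 < u" for u
    using that weight_le[of u] weight_nonneg[of u] by (simp add: mirror_def abs_mult mult.commute)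
  have "\<bar>mirror u * weight u\<bar> \<le> std_normal_density u * \<bar>u\<bar>" for u
  proof (cases u "0::real" rule: linorder_cases)
    case less
    then have "\<bar>mirror (- u) * weight (- u)\<bar> \<le> std_normal_density u * \<bar>u\<bar>"
      using *[of "-u"] by (simp only: std_normal_density_uminus abs_minus_cancel)
    then show ?thesis by (simp only: weight_odd abs_minus_cancel)
  qed (use * in \<open>auto simp: weight_def base_def\<close>)
  then show "AE u in lborel. norm (mirror u * weight u) \<le> norm (std_normal_density u * \<bar>u\<bar> ^ 1)"
    by simp
qed simp

definition total :: real where "total = (LINT u|lborel. weight u)"

lemma total_pos: "0 < total"
proof (rule ccontr)
  assume "\<not> 0 < total"
  moreover have "0 \<le> total"
    unfolding total_def by (rule Bochner_Integration.integral_nonneg) (simp add: weight_nonneg)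
  ultimately have "total = 0" by simp
  then have "AE u in lborel. weight u = 0"
    using integral_nonneg_eq_0_iff_AE[OF integrable_weight] by (simp add: total_def weight_nonneg)
  then have "AE u in lborel. u \<notin> base"
    by eventually_elim (use weight_pos_iff in force)
  then have "base \<in> null_sets lborel"
    using open_base by (subst (asm) AE_iff_null) auto
  then show False using open_not_null_lborel[OF open_base base_not_empty] by simp
qed

section \<open>The mixture of two-point laws and its reciprocating function\<close>

definition mix :: "real measure" where
  "mix = distr (density lborel (\<lambda>u. ennreal (weight u / total))) borel mirror"

text \<open>Since \<open>weight\<close> is positive exactly on \<open>base\<close>, null sets of
  \<open>mix\<close> correspond to Lebesgue-null preimages in \<open>base\<close>. Non-atomicity and
  the support are both read off from this.\<close>

lemma AE_mix_iff:
  assumes "{z. P z} \<in> sets borel"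
  shows "(AE z in mix. P z) \<longleftrightarrow> (AE u in lborel. u \<in> base \<longrightarrow> P (mirror u))"
proof -
  have "(AE z in mix. P z) \<longleftrightarrow> (AE u in lborel. 0 < ennreal (weight u / total) \<longrightarrow> P (mirror u))"
    unfolding mix_def using assms by (subst AE_distr_iff, simp, simp, subst AE_density) auto
  moreover have "0 < ennreal (weight u / total) \<longleftrightarrow> u \<in> base" for u
    using total_pos weight_pos_iff by (simp add: zero_less_divide_iff)
  ultimately show ?thesis by simp
qed

lemma integral_mix:
  fixes f :: "real \<Rightarrow> real"
  assumes [measurable]: "f \<in> borel_measurable borel"
  shows "(LINT z|mix. f z) = (LINT u|lborel. f (mirror u) * weight u) / total"
    and "integrable mix f \<longleftrightarrow> integrable lborel (\<lambda>u. f (mirror u) * weight u)"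
proof -
  have "(LINT z|mix. f z) = (LINT u|lborel. (weight u / total) *\<^sub>R f (mirror u))"
    unfolding mix_def using total_pos
    by (subst integral_distr, simp, simp, subst integral_density) (auto simp: weight_nonneg)
  then show "(LINT z|mix. f z) = (LINT u|lborel. f (mirror u) * weight u) / total"
    by (simp add: mult.commute)
  have "integrable mix f \<longleftrightarrow> integrable lborel (\<lambda>u. (weight u / total) *\<^sub>R f (mirror u))"
    unfolding mix_def using total_pos
    by (subst integrable_distr_eq, simp, simp, subst integrable_density) (auto simp: weight_nonneg)
  also have "(\<lambda>u. (weight u / total) *\<^sub>R f (mirror u)) = (\<lambda>u. (1 / total) * (f (mirror u) * weight u))"
    by auto
  finally show "integrable mix f \<longleftrightarrow> integrable lborel (\<lambda>u. f (mirror u) * weight u)"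
    using total_pos integrable_mult_left_iff[where M=lborel and c="1 / total" and f="\<lambda>u. f (mirror u) * weight u"]
    by simp
qed

lemma real_distribution_mix: "real_distribution mix"
proof -
  have "prob_space (density lborel (\<lambda>u. ennreal (weight u / total)))"
  proof (rule prob_spaceI)
    have "(\<integral>\<^sup>+ u. ennreal (weight u / total) \<partial>lborel) = ennreal (LINT u|lborel. weight u / total)"
      using integrable_weight weight_nonneg total_pos by (intro nn_integral_eq_integral) auto
    also have "\<dots> = 1" using total_pos by (simp flip: total_def)
    finally show "emeasure (density lborel (\<lambda>u. ennreal (weight u / total)))
        (space (density lborel (\<lambda>u. ennreal (weight u / total)))) = 1"
      by (simp add: emeasure_density)
  qed
  then have "prob_space mix" unfolding mix_def by (rule prob_space.prob_space_distr) simp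
  then show ?thesis
    by (simp add: real_distribution_def real_distribution_axioms_def mix_def)
qed

lemma nonatomic_mix: "nonatomic mix"
  unfolding nonatomic_iff_singletons_null[OF real_distribution_mix]
proof
  fix y
  interpret real_distribution mix by (rule real_distribution_mix)
  \<comment> \<open>By injectivity at most one point of \<open>base\<close> is mapped to
    \<open>y\<close>.\<close>
  have "AE u in lborel. u \<in> base \<longrightarrow> mirror u \<noteq> y"
  proof (cases "\<exists>v\<in>base. mirror v = y")
    case True
    then obtain v where v: "v \<in> base" "mirror v = y" by blast
    show ?thesis using AE_lborel_singleton[of v]
      by eventually_elim (use v inj_on_mirror in \<open>auto dest: inj_onD\<close>)
  qed auto
  then have "AE z in mix. z \<noteq> y" by (subst AE_mix_iff) auto
  then have "{y} \<in> null_sets mix" by (subst (asm) AE_iff_null) auto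
  then show "measure mix {y} = 0" by (rule measure_eq_0_null_sets)
qed

lemma zero_mean_mix: "zero_mean mix"
proof -
  \<comment> \<open>The reflection preserves Lebesgue measure, and by \<open>weight_odd\<close> it
    negates the integrand.\<close>
  have "(LINT u|lborel. mirror u * weight u) = (LINT u|lborel. mirror (- u) * weight (- u))"
    using lborel_integral_real_affine[of "-1" "\<lambda>u. mirror u * weight u" 0] by simp
  then have "(LINT u|lborel. mirror u * weight u) = 0" by (simp add: weight_odd)
  then show ?thesis
    by (simp add: zero_mean_def integral_mix integrable_mirror_weight)
qed

lemma msupp_mix: "msupp mix = {x. a_minus \<le> ereal x \<and> ereal x \<le> a_plus}"
proof (intro equalityI subsetI)
  interpret real_distribution mix by (rule real_distribution_mix)
  let ?I = "{x. a_minus \<le> ereal x \<and> ereal x \<le> a_plus}"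
  fix x assume x: "x \<in> msupp mix"
  have "closed (ereal -` {a_minus..a_plus})" by (intro closed_vimage continuous_intros)
  moreover have "ereal -` {a_minus..a_plus} = ?I" by auto
  ultimately have closed: "closed ?I" by simp
  then have "AE z in mix. z \<in> ?I"
    by (subst AE_mix_iff) (auto simp: less_imp_le mirror_in_interval)
  then have "- ?I \<in> null_sets mix"
    using closed by (subst (asm) AE_iff_null) (auto simp: Collect_neg_eq Compl_eq)
  then show "x \<in> ?I"
    using x closed unfolding msupp_def null_sets_def by (auto simp: open_Compl)
next
  interpret real_distribution mix by (rule real_distribution_mix)
  fix x assume x: "x \<in> {x. a_minus \<le> ereal x \<and> ereal x \<le> a_plus}"
  show "x \<in> msupp mix"
    unfolding msupp_def
  proof (intro CollectI allI impI, rule ccontr)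
    fix U assume U: "open U \<and> x \<in> U" and "\<not> 0 < emeasure mix U"
    then have "U \<in> null_sets mix" by (auto simp: null_sets_def)
    then have "AE z in mix. z \<notin> U" using U by (subst AE_iff_null) auto
    moreover have "{z. z \<notin> U} \<in> sets borel"
      using U by (metis Compl_eq borel_comp borel_open)
    ultimately have "AE u in lborel. u \<notin> mirror -` U \<inter> base"
      by (subst (asm) AE_mix_iff) (auto elim!: eventually_mono)
    \<comment> \<open>A Lebesgue-null open set is empty, so \<open>mirror\<close> takes no value in
      \<open>U\<close> on \<open>base\<close>.\<close>
    moreover have op: "open (mirror -` U \<inter> base)"
      using continuous_on_open_vimage[OF open_base] continuous_mirror U by blast
    ultimately have "mirror -` U \<inter> base \<in> null_sets lborel"
      by (subst AE_iff_null_sets) auto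
    then have empty: "mirror -` U \<inter> base = {}" using open_not_null_lborel[OF op] by blast
    obtain e where e: "0 < e" "ball x e \<subseteq> U"
      using U by (meson openE)
    have in_U: "y \<in> U" if "\<bar>x - y\<bar> < e" for y
      using e(2) that by (auto simp: dist_real_def)
    \<comment> \<open>Moving slightly from \<open>x\<close> towards \<open>0\<close>, or to the
      right if \<open>x\<close> is \<open>0\<close>, gives a nonzero point of \<open>U\<close>
      strictly inside the interval. By \<open>mirror_surj\<close> it is a value of
      \<open>mirror\<close> on \<open>base\<close>, a contradiction.\<close>
    have "\<exists>y\<in>U. a_minus < ereal y \<and> ereal y < a_plus \<and> y \<noteq> 0"
    proof (cases x "0::real" rule: linorder_cases)
      case less
      then obtain y where y: "x < y" "y < min 0 (x + e)" using e(1) dense[of x "min 0 (x + e)"] by auto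
      have "ereal y < a_plus" by (rule less_trans[OF _ pos]) (use y in simp)
      moreover have "a_minus < ereal y" using x y le_less_trans[of a_minus "ereal x" "ereal y"] by simp
      ultimately show ?thesis using y in_U[of y] by (intro bexI[of _ y]) auto
    next
      case equal
      then obtain y where y: "0 < ereal y" "ereal y < min (ereal e) a_plus"
        using e(1) pos ereal_dense2[of 0 "min (ereal e) a_plus"] by auto
      have "a_minus < ereal y" by (rule less_trans[OF neg y(1)])
      then show ?thesis using equal y in_U[of y] by (intro bexI[of _ y]) auto
    next
      case greater
      then obtain y where y: "y < x" "max 0 (x - e) < y" using e(1) dense[of "max 0 (x - e)" x] by auto
      have "a_minus < ereal y" by (rule less_trans[OF neg]) (use y in simp)
      moreover have "ereal y < a_plus" using x y less_le_trans[of "ereal y" "ereal x" a_plus] by simp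
      ultimately show ?thesis using y in_U[of y] by (intro bexI[of _ y]) auto
    qed
    then show False using mirror_surj empty by blast
  qed
qed

text \<open>The reflection swaps the atoms, whose contributions agree by \<open>weight_odd\<close>.
  The truncations agree too: as \<open>s\<close> is strictly decreasing, one atom is at most
  \<open>x\<close> exactly when its partner is at least \<open>s x\<close>.\<close>

lemma G_fun_mix_s:
  assumes x: "x \<in> {0..a_plus}"
  shows "G_fun mix (s x) = G_fun mix x"
proof (cases "x = 0")
  case False
  then have "0 < x" using x by (simp add: less_le)
  then have sx: "\<not> 0 \<le> s x"
    using monotone_onD[OF strict_antimono, of 0 x] x less_imp_le[OF pos] s_0 by auto
  have "G_fun mix (s x)
      = (LINT u|lborel. indicator {z. s x \<le> ereal z \<and> z < 0} (mirror u) * - mirror u * weight u) / total"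
    using sx by (simp add: G_fun_def set_lebesgue_integral_def integral_mix)
  also have "(LINT u|lborel. indicator {z. s x \<le> ereal z \<and> z < 0} (mirror u) * - mirror u * weight u)
      = (LINT u|lborel. indicator {z. s x \<le> ereal z \<and> z < 0} (mirror (- u)) * - mirror (- u) * weight (- u))"
    using lborel_integral_real_affine[of "-1" "\<lambda>u. indicator {z. s x \<le> ereal z \<and> z < 0} (mirror u) * - mirror u * weight u" 0]
    by simp
  also have "\<dots> = (LINT u|lborel. indicator {z. 0 < z \<and> ereal z \<le> x} (mirror u) * mirror u * weight u)"
  proof (rule Bochner_Integration.integral_cong)
    fix u
    show "indicator {z. s x \<le> ereal z \<and> z < 0} (mirror (- u)) * - mirror (- u) * weight (- u)
        = indicator {z. 0 < z \<and> ereal z \<le> x} (mirror u) * mirror u * weight u"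
    proof (cases "u \<in> base")
      case True
      have "s x \<le> ereal (mirror (- u)) \<longleftrightarrow> ereal (mirror u) \<le> x" if "0 < u"
      proof -
        have "ereal (mirror (- u)) = s (ereal u)" "mirror u = u" "ereal u \<in> {0..a_plus}"
          using that True mirror_neg[of "-u"] by (auto simp: mirror_def base_def)
        then show ?thesis
          using monotone_onD[OF strict_antimono, of x "ereal u"]
            monotone_onD[OF strict_antimono, of "ereal u" x] x
          by (cases x "ereal u" rule: linorder_cases) auto
      qed
      then have "(s x \<le> ereal (mirror (- u)) \<and> mirror (- u) < 0) \<longleftrightarrow> (0 < mirror u \<and> ereal (mirror u) \<le> x)"
        using mirror_in_interval(3,4)[of u] mirror_in_interval(3,4)[of "-u"] True by auto
      then show ?thesis using weight_odd[of u] by (simp add: indicator_def)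
    qed (simp add: weight_def)
  qed simp
  also have "\<dots> / total = G_fun mix x"
    using x by (simp add: G_fun_def set_lebesgue_integral_def integral_mix)
  finally show ?thesis .
qed (simp add: s_0)

lemma reciprocating_mix:
  assumes "0 \<le> x" shows "reciprocating mix x = s x"
proof -
  interpret real_distribution mix by (rule real_distribution_mix)
  interpret centered_interval_distribution mix a_minus a_plus
    by unfold_locales (fact nonatomic_mix zero_mean_mix msupp_mix neg pos)+
  show ?thesis
  proof (cases "x < a_plus")
    case True
    then have "s x \<in> {a_minus..0}" using s_between[of x] assms s_0 neg by (cases "x = 0") (auto simp: less_imp_le)
    then show ?thesis using reciprocating_eqI G_fun_mix_s[of x] True assms by auto
  next
    case False
    then show ?thesis using reciprocating_above s_above by simp
  qed
qed

end

section \<open>Uniqueness and the equivalence\<close>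

lemma reciprocating_extension_iff_locale:
  assumes "a_minus < 0" "0 < a_plus"
  shows "reciprocating_extension a_minus a_plus s r \<longleftrightarrow>
    (\<forall>x\<in>{0..\<infinity>}. r x = s x) \<and>
    (\<exists>M. centered_interval_distribution M a_minus a_plus \<and> r = reciprocating M)"
  using assms
  by (auto simp: reciprocating_extension_def centered_interval_distribution_def
      centered_interval_distribution_axioms_def)

text \<open>At a negative argument \<open>x\<close>, both extensions take values in
  \<open>{0..a_plus}\<close> that \<open>s\<close> maps to \<open>max x a_minus\<close>; strict
  decrease of \<open>s\<close> leaves only one such value.\<close>

lemma reciprocating_extension_unique:
  assumes lt: "a_minus < 0" "0 < a_plus" and anti: "strict_antimono_on {0..a_plus} s"
    and r1: "reciprocating_extension a_minus a_plus s r1"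
    and r2: "reciprocating_extension a_minus a_plus s r2"
  shows "r1 = r2"
proof
  fix x
  show "r1 x = r2 x"
  proof (cases "0 \<le> x")
    case True
    then show ?thesis using r1 r2 by (simp add: reciprocating_extension_def)
  next
    case False
    have *: "r x \<in> {0..a_plus} \<and> s (r x) = max x a_minus"
      if r: "reciprocating_extension a_minus a_plus s r" for r
    proof -
      obtain M where M: "centered_interval_distribution M a_minus a_plus" "r = reciprocating M"
          "\<forall>x\<in>{0..\<infinity>}. r x = s x"
        using r by (auto simp: reciprocating_extension_iff_locale[OF lt])
      interpret centered_interval_distribution M a_minus a_plus by fact
      show ?thesis using reciprocating_nonpos[of x] False M by auto
    qed
    show ?thesis
      using *[OF r1] *[OF r2] monotone_onD[OF anti, of "r1 x" "r2 x"]
        monotone_onD[OF anti, of "r2 x" "r1 x"]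
      by (cases "r1 x" "r2 x" rule: linorder_cases) auto
  qed
qed

theorem proposition3p34:
  fixes a_minus a_plus :: ereal and s :: "ereal \<Rightarrow> ereal"
  assumes "-\<infinity> \<le> a_minus" "a_minus < 0" "0 < a_plus" "a_plus \<le> \<infinity>"
  shows "((\<exists>r. reciprocating_extension a_minus a_plus s r) \<longleftrightarrow>
            (s 0 = 0 \<and> strict_antimono_on {0..a_plus} s \<and> continuous_on {0..\<infinity>} s \<and>
             (\<forall>x\<in>{a_plus..\<infinity>}. s x = a_minus))) \<and>
         (s 0 = 0 \<and> strict_antimono_on {0..a_plus} s \<and> continuous_on {0..\<infinity>} s \<and>
             (\<forall>x\<in>{a_plus..\<infinity>}. s x = a_minus) \<longrightarrow>
            (\<exists>!r. reciprocating_extension a_minus a_plus s r))"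
proof -
  let ?II = "s 0 = 0 \<and> strict_antimono_on {0..a_plus} s \<and> continuous_on {0..\<infinity>} s \<and>
             (\<forall>x\<in>{a_plus..\<infinity>}. s x = a_minus)"
  have atLeast_infinity: "{0..\<infinity>} = {0::ereal..}" by auto
  have "?II" if ext: "reciprocating_extension a_minus a_plus s r" for r
  proof -
    obtain M where M: "centered_interval_distribution M a_minus a_plus" "r = reciprocating M"
        and rs: "\<And>x. 0 \<le> x \<Longrightarrow> r x = s x"
      using ext by (auto simp: reciprocating_extension_iff_locale[OF assms(2,3)])
    interpret centered_interval_distribution M a_minus a_plus by fact
    have eq: "s x = reciprocating M x" if "0 \<le> x" for x using rs[OF that] M(2) by simp
    have "continuous_on {0..} s"
      using continuous_reciprocating
      by (rule continuous_on_cong[THEN iffD2, rotated -1]) (auto simp: eq)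
    moreover have "strict_antimono_on {0..a_plus} s"
      using reciprocating_strict_antimono by (auto simp: monotone_on_def eq)
    moreover have "\<forall>x\<in>{a_plus..\<infinity>}. s x = a_minus"
      using reciprocating_above assms(3) by (auto simp: eq)
    ultimately show ?thesis by (simp add: eq reciprocating_0 atLeast_infinity)
  qed
  moreover have "\<exists>r. reciprocating_extension a_minus a_plus s r" if II: "?II"
  proof -
    interpret decreasing_extension a_minus a_plus s
      using II assms by unfold_locales (auto simp: atLeast_infinity)
    show ?thesis
      unfolding reciprocating_extension_def
      using real_distribution_mix nonatomic_mix zero_mean_mix msupp_mix reciprocating_mix
      by (intro exI[of _ "reciprocating mix"]) auto
  qed
  ultimately show ?thesis
    using reciprocating_extension_unique[OF assms(2,3)] by blast
qed

end
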